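(* Let $\rho(t)\in\mathcal D(\mathcal H)$ be the state of a controlled finite-dimensional quantum system, let $V:\mathcal D(\mathcal H)\to[0,\infty)$ be a continuous measurement-derived Lyapunov observable, let $t_n:=t_0+n\tau$ ($\tau>0$) be the sampling instants, and let $V_n:=V(t_n)=V(\rho(t_n))$. Put $\mathcal I:=\{\rho\in\mathcal D(\mathcal H): V(\rho)=0\}$. Assume that: 1. $0\le V_n\le V_{\max}$ for all $n$; 2. the adaptive sign-based controller is implemented in sampled-data form with zero-order hold on each interval $[t_n,t_{n+1})$; 3. for every $\rho\notin\mathcal I$ the closed-loop law enforces finite-difference descent, in the sense that (when $\rho(t_n)=\rho\notin\mathcal I$), whenever $V$ is not locally constant on the sampling window $[t_n,t_{n+1})$, one has $V_{n+1}-V_n<0$; 4. stagnation above any strictly positive value is impossible, i.e. the sampled sequence $(V_n)$ cannot converge to any strictly positive limit. Then the limit $V_\infty:=\lim_{n\to\infty}V_n$ exists and satisfies $V_\infty=0$. In particular, $$\lim_{n\to\infty}\mathrm{dist}\bigl(\rho(t_n),\mathcal I\bigr)=0.$$ If $V$ is proper (i.e. $V(\rho)=0$ iff $\rho\in\mathcal I$), then $\lim_{n\to\infty}\rho(t_n)\in\mathcal I$, meaning, equivalently, $\mathrm{dist}(\rho(t_n),\mathcal I)\to0$.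
   Context: $\mathcal H\cong\mathbb C^d$ is a finite-dimensional Hilbert space and $\mathcal D(\mathcal H)=\{X\in\mathbb C^{d\times d}: X\succeq 0,\ \mathrm{Tr}(X)=1\}$ the compact convex set of density operators. The setting is drift-free: $\dot\rho(t)=\sum_{k=1}^m u_k(t)[-iH_k,\rho(t)]$ with Hermitian $H_1,\dots,H_m$. Adaptive sign-based controller: with gains $\kappa_k(t_n)>0$ and constants $\alpha_k>0$, $$u_k(t)=-\kappa_k(t_n)\,\mathrm{sign}\bigl(V(t_n)-V(t_{n-1})\bigr)\quad\text{for } t\in[t_n,t_{n+1}),\qquad \kappa_k(t_{n+1})=\kappa_k(t_n)+\alpha_k\,|V(t_n)-V(t_{n-1})|.$$ Convention: $V$ being locally constant on a sampling window is equivalent to the increment of $V$ over that window being zero, i.e. on $[t_n,t_{n+1})$ it means $V_{n+1}=V_n$. The distance $\mathrm{dist}$ is taken in any norm on $\mathbb C^{d\times d}$.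
   Formalization: The formal theorem adds the assumption that if ρ(t_n) lies in I then ρ(t_{n+1}) lies in I; without it the claim is false, since hypothesis 3 says nothing about windows starting in I and V_n can alternate 0,1,0,1,…. *)

theory Defs
  imports "HOL-Analysis.Analysis"
begin

definition cscale :: "complex \<Rightarrow> complex ^ 'd ^ 'd \<Rightarrow> complex ^ 'd ^ 'd" where
  "cscale c A = (\<chi> i j. c * A $ i $ j)"

definition hermitian_matrix :: "complex ^ 'd ^ 'd \<Rightarrow> bool" where
  "hermitian_matrix A \<longleftrightarrow> (\<chi> i j. cnj (A $ j $ i)) = A"

text \<open>The quadratic form of a Hermitian matrix is real, so taking its real part loses nothing.\<close>
definition pos_semidef :: "complex ^ 'd ^ 'd \<Rightarrow> bool" where
  "pos_semidef A \<longleftrightarrow> hermitian_matrix A \<and>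
     (\<forall>x :: complex ^ 'd. 0 \<le> Re (\<Sum>i\<in>UNIV. \<Sum>j\<in>UNIV. cnj (x $ i) * A $ i $ j * x $ j))"

definition density_operators :: "(complex ^ 'd ^ 'd) set" where
  "density_operators = {X. pos_semidef X \<and> trace X = 1}"

definition commutator :: "complex ^ 'd ^ 'd \<Rightarrow> complex ^ 'd ^ 'd \<Rightarrow> complex ^ 'd ^ 'd" where
  "commutator A B = A ** B - B ** A"

definition zero_set :: "(complex ^ 'd ^ 'd \<Rightarrow> real) \<Rightarrow> (complex ^ 'd ^ 'd) set" where
  "zero_set V = {\<rho> \<in> density_operators. V \<rho> = 0}"

text \<open>An arbitrary norm on the complex vector space of matrices.\<close>
definition is_norm :: "(complex ^ 'd ^ 'd \<Rightarrow> real) \<Rightarrow> bool" where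
  "is_norm N \<longleftrightarrow>
     (\<forall>X. 0 \<le> N X) \<and> (\<forall>X. N X = 0 \<longleftrightarrow> X = 0) \<and>
     (\<forall>c X. N (cscale c X) = cmod c * N X) \<and>
     (\<forall>X Y. N (X + Y) \<le> N X + N Y)"

text \<open>Extended-real valued, so that the distance to the empty set is \<open>\<infinity>\<close>
  (and not \<open>0\<close>, as it would be with the library's \<open>infdist\<close>).\<close>
definition set_dist ::
  "(complex ^ 'd ^ 'd \<Rightarrow> real) \<Rightarrow> complex ^ 'd ^ 'd \<Rightarrow> (complex ^ 'd ^ 'd) set \<Rightarrow> ereal" where
  "set_dist N X S = (INF Y\<in>S. ereal (N (X - Y)))"

definition sample_time :: "real \<Rightarrow> real \<Rightarrow> nat \<Rightarrow> real" where
  "sample_time t0 \<tau> n = t0 + real n * \<tau>"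

definition window :: "real \<Rightarrow> real \<Rightarrow> nat \<Rightarrow> real set" where
  "window t0 \<tau> n = {sample_time t0 \<tau> n ..< sample_time t0 \<tau> (Suc n)}"

text \<open>The input jumps at the sampling instants, so the differential equation is required on each
  half-open window (with the right derivative at its left endpoint), and the pieces are joined
  continuously.\<close>
definition controlled_evolution ::
  "nat \<Rightarrow> (nat \<Rightarrow> complex ^ 'd ^ 'd) \<Rightarrow> (nat \<Rightarrow> real \<Rightarrow> real) \<Rightarrow> real \<Rightarrow> real \<Rightarrow>
   (real \<Rightarrow> complex ^ 'd ^ 'd) \<Rightarrow> bool" where
  "controlled_evolution m H u t0 \<tau> \<rho> \<longleftrightarrow>
     continuous_on {t0..} \<rho> \<and>
     (\<forall>n. \<forall>t\<in>window t0 \<tau> n.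
        (\<rho> has_vector_derivative
          (\<Sum>k=1..m. u k t *\<^sub>R commutator (cscale (- \<i>) (H k)) (\<rho> t)))
        (at t within window t0 \<tau> n))"

text \<open>Here \<open>v n\<close> is the sample of the observable at the \<open>n\<close>-th sampling instant and \<open>\<kappa> k n\<close>
  is the gain in force on the \<open>n\<close>-th window.  The sign law and the gain update refer to the preceding
  sample, which exists only for \<open>n \<ge> 1\<close>; the startup input on the first window is an arbitrary
  constant, which covers every choice of a fictitious sample before the initial time.\<close>
definition adaptive_sign_controller ::
  "nat \<Rightarrow> (nat \<Rightarrow> real) \<Rightarrow> (nat \<Rightarrow> nat \<Rightarrow> real) \<Rightarrow> (nat \<Rightarrow> real \<Rightarrow> real) \<Rightarrow>
   real \<Rightarrow> real \<Rightarrow> (nat \<Rightarrow> real) \<Rightarrow> bool" where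
  "adaptive_sign_controller m \<alpha> \<kappa> u t0 \<tau> v \<longleftrightarrow>
     (\<forall>k\<in>{1..m}.
        \<alpha> k > 0 \<and>
        (\<forall>n. \<kappa> k n > 0) \<and>
        (\<forall>n. \<forall>t\<in>window t0 \<tau> n. u k t = u k (sample_time t0 \<tau> n)) \<and>
        (\<forall>n\<ge>1. \<forall>t\<in>window t0 \<tau> n. u k t = - \<kappa> k n * sgn (v n - v (n - 1))) \<and>
        (\<forall>n\<ge>1. \<kappa> k (Suc n) = \<kappa> k n + \<alpha> k * \<bar>v n - v (n - 1)\<bar>))"

text \<open>By convention, local constancy on a sampling window is a statement about the sampled
  increment only.\<close>
definition constant_on_window :: "(nat \<Rightarrow> real) \<Rightarrow> nat \<Rightarrow> bool" where
  "constant_on_window v n \<longleftrightarrow> v (Suc n) = v n"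

end

(* The samples of V decrease, since descent holds off the target and the target is invariant, so they
   converge, and by no stagnation the limit is 0. For e > 0 the points of the compact set of density
   operators at distance at least e from the zero set form a compact set on which V has a positive
   minimum; the samples of V fall below it, so the states eventually avoid this set. Finally, an
   arbitrary norm is dominated by a multiple of the Euclidean one. *)

theory Submission
  imports Defs
begin

lemma density_operators_form_nonneg:
  assumes "A \<in> density_operators"
  shows "0 \<le> Re (\<Sum>i\<in>UNIV. \<Sum>j\<in>UNIV. cnj (x $ i) * A $ i $ j * x $ j)"
  using assms by (auto simp: density_operators_def pos_semidef_def)

lemma density_operators_cnj:
  assumes "A \<in> density_operators"
  shows "cnj (A $ j $ i) = A $ i $ j"
  using assms
  by (auto simp: density_operators_def pos_semidef_def hermitian_matrix_def vec_eq_iff)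

text \<open>The quadratic form evaluated at \<open>e_i + c e_j\<close>. Writing the vector as a sum
  of two indicators keeps the identity valid for \<open>i = j\<close>, where the vector is
  \<open>(1 + c) e_i\<close>.\<close>

lemma form_two_entries:
  fixes A :: "complex ^ 'd ^ 'd"
  defines "x \<equiv> \<lambda>i j c. \<chi> p. (if p = i then 1 else 0) + (if p = j then c else 0)"
  shows "(\<Sum>p\<in>UNIV. \<Sum>q\<in>UNIV. cnj (x i j c $ p) * A $ p $ q * x i j c $ q)
    = A $ i $ i + c * A $ i $ j + cnj c * A $ j $ i + cnj c * c * A $ j $ j"
proof -
  \<comment> \<open>Sifting rules: a product with one entry of the vector splits into two indicator
    terms, so each of the two sums collapses in turn.\<close>
  have right: "B * x i j c $ q = (if q = i then B else 0) + (if q = j then c * B else 0)"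
    and left: "cnj (x i j c $ q) * B = (if q = i then B else 0) + (if q = j then cnj c * B else 0)"
    for q B
    by (simp_all add: x_def algebra_simps)
  have "(\<Sum>q\<in>UNIV. cnj (x i j c $ p) * A $ p $ q * x i j c $ q)
      = cnj (x i j c $ p) * (A $ p $ i + c * A $ p $ j)" for p
    by (simp add: right sum.distrib distrib_left mult.left_commute)
  then show ?thesis
    by (simp add: left sum.distrib distrib_left mult.assoc)
qed

text \<open>Positivity of the form at \<open>e_i + c e_j\<close> for a suitable phase
  \<open>c\<close> yields \<open>2 |A_ij| \<le> A_ii + A_jj\<close>, and each diagonal entry is at
  most 1 because they are nonnegative with sum 1.\<close>

lemma density_operators_entry_bound:
  assumes A: "A \<in> density_operators"
  shows "cmod (A $ i $ j) \<le> 1"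
proof -
  have form: "0 \<le> Re (A $ i $ i + c * A $ i $ j + cnj c * A $ j $ i + cnj c * c * A $ j $ j)"
    for i j c
    using density_operators_form_nonneg[OF A,
        of "\<chi> p. (if p = i then 1 else 0) + (if p = j then c else 0)"]
    unfolding form_two_entries .
  have diag_nonneg: "0 \<le> Re (A $ i $ i)" for i
    using form[of i 0] by simp
  have "(\<Sum>i\<in>UNIV. A $ i $ i) = 1"
    using A by (simp add: density_operators_def trace_def)
  then have "(\<Sum>i\<in>UNIV. Re (A $ i $ i)) = 1"
    by (simp flip: Re_sum)
  then have diag_le: "Re (A $ i $ i) \<le> 1" for i
    using member_le_sum[of i UNIV "\<lambda>i. Re (A $ i $ i)"] diag_nonneg by simp
  show ?thesis
  proof (cases "A $ i $ j = 0")
    case False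
    \<comment> \<open>This unit phase rotates \<open>A $ i $ j\<close> onto the negative real axis;
      by hermiticity the conjugate term takes the same value, so the two add up to
      \<open>-2 |A_ij|\<close>.\<close>
    define c where "c = - cnj (A $ i $ j) / cmod (A $ i $ j)"
    have c: "c * A $ i $ j = - cmod (A $ i $ j)"
      using False complex_norm_square[of "A $ i $ j"]
      by (simp add: c_def divide_eq_eq mult.commute power2_eq_square)
    have "cnj c * A $ j $ i = cnj (c * A $ i $ j)"
      by (simp add: density_operators_cnj[OF A])
    then have c': "cnj c * A $ j $ i = - cmod (A $ i $ j)"
      by (simp add: c)
    have "cmod c = 1"
      using False by (simp add: c_def norm_divide)
    then have "cnj c * c = 1"
      using complex_norm_square[of c] by (simp add: mult.commute)
    then have "2 * cmod (A $ i $ j) \<le> Re (A $ i $ i) + Re (A $ j $ j)"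
      using form[of i c j] c c' by simp
    then show ?thesis
      using diag_le[of i] diag_le[of j] by linarith
  qed simp
qed

text \<open>Heine-Borel: the entry bound gives boundedness (by the square of the dimension), and all
  defining conditions are closed conditions on the entries.\<close>

lemma compact_density_operators: "compact (density_operators :: (complex ^ 'd ^ 'd) set)"
proof -
  have "norm A \<le> (\<Sum>i\<in>(UNIV :: 'd set). \<Sum>j\<in>(UNIV :: 'd set). 1)"
    if A: "A \<in> density_operators" for A :: "complex ^ 'd ^ 'd"
  proof -
    have "norm A \<le> (\<Sum>i\<in>UNIV. norm (A $ i))"
      by (simp add: norm_vec_def L2_set_le_sum)
    also have "\<dots> \<le> (\<Sum>i\<in>UNIV. \<Sum>j\<in>UNIV. cmod (A $ i $ j))"
      by (intro sum_mono) (simp add: norm_vec_def[of "_ :: complex ^ 'd"] L2_set_le_sum)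
    also have "\<dots> \<le> (\<Sum>i\<in>(UNIV :: 'd set). \<Sum>j\<in>(UNIV :: 'd set). 1)"
      by (intro sum_mono density_operators_entry_bound A)
    finally show ?thesis .
  qed
  then have "bounded (density_operators :: (complex ^ 'd ^ 'd) set)"
    by (rule boundedI)
  moreover have "closed (density_operators :: (complex ^ 'd ^ 'd) set)"
    unfolding density_operators_def pos_semidef_def hermitian_matrix_def trace_def
    by (intro closed_Collect_conj closed_Collect_all closed_Collect_le closed_Collect_eq
        continuous_intros)
  ultimately show ?thesis
    by (simp add: compact_eq_bounded_closed)
qed

text \<open>The sequence itself need not converge; compactness only forces it towards the zeros of
  \<open>V\<close>. The conclusion includes that \<open>V\<close> has a zero in
  \<open>D\<close>.\<close>

lemma compact_minimizing_sequence:
  fixes V :: "'a::metric_space \<Rightarrow> real"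
  assumes "compact D" and cont: "continuous_on D V"
    and nonneg: "\<And>y. y \<in> D \<Longrightarrow> 0 \<le> V y"
    and x: "\<And>n. x n \<in> D" and lim: "(\<lambda>n. V (x n)) \<longlonglongrightarrow> 0" and "e > 0"
  shows "\<forall>\<^sub>F n in sequentially. \<exists>z\<in>{y \<in> D. V y = 0}. dist (x n) z < e"
proof -
  \<comment> \<open>Quantifying over the zeros makes \<open>K\<close> all of \<open>D\<close> if
    \<open>V\<close> has none, so that case needs no separate treatment.\<close>
  define K where "K = D \<inter> {y. \<forall>z\<in>{y \<in> D. V y = 0}. e \<le> dist y z}"
  have "closed {y. \<forall>z\<in>{y \<in> D. V y = 0}. e \<le> dist y z}"
    unfolding Ball_def
    by (intro closed_Collect_all closed_Collect_imp closed_Collect_le continuous_intros) simp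
  then have "compact K"
    unfolding K_def using \<open>compact D\<close> by (rule compact_Int_closed[rotated])
  have "\<forall>\<^sub>F n in sequentially. x n \<notin> K"
  proof (cases "K = {}")
    case False
    have "continuous_on K V"
      using cont by (rule continuous_on_subset) (simp add: K_def)
    then obtain w where w: "w \<in> K" "\<And>y. y \<in> K \<Longrightarrow> V w \<le> V y"
      using continuous_attains_inf[OF \<open>compact K\<close> False] by blast
    \<comment> \<open>A zero of \<open>V\<close> in \<open>K\<close> would have distance at least
      \<open>e > 0\<close> from itself.\<close>
    have "V w \<noteq> 0"
      using w(1) \<open>e > 0\<close> by (auto simp: K_def)
    then have "0 < V w"
      using w(1) nonneg[of w] by (simp add: K_def)
    from order_tendstoD(2)[OF lim this] show ?thesis
      by eventually_elim (use w(2) in force)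
  qed simp
  then show ?thesis
    by eventually_elim (use x in \<open>auto simp: K_def not_le\<close>)
qed

text \<open>One half of the equivalence of norms: expand \<open>X\<close> in the matrix units
  \<open>E i j\<close> and bound each coefficient by \<open>norm X\<close>.\<close>

lemma is_norm_le_norm:
  fixes N :: "complex ^ 'd ^ 'd \<Rightarrow> real"
  assumes N: "is_norm N"
  obtains C where "C > 0" "\<And>X. N X \<le> C * norm X"
proof
  define E :: "'d \<Rightarrow> 'd \<Rightarrow> complex ^ 'd ^ 'd" where "E i j = axis i (axis j 1)" for i j
  let ?C = "\<Sum>i\<in>UNIV. \<Sum>j\<in>UNIV. N (E i j)"
  have nonneg: "0 \<le> N X" and zero: "N 0 = 0" and scale: "N (cscale c X) = cmod c * N X"
    and triangle: "N (X + Y) \<le> N X + N Y" for X Y c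
    using N by (auto simp: is_norm_def)
  \<comment> \<open>The added 1 makes the constant visibly positive, so that a radius can later be
    divided by it.\<close>
  show "0 < ?C + 1"
    by (intro add_nonneg_pos sum_nonneg nonneg) simp
  have sum_le: "N (sum f S) \<le> (\<Sum>i\<in>S. N (f i))" if "finite S" for f and S :: "'d set"
    using that by (induction) (auto simp: zero intro: order_trans[OF triangle])
  fix X :: "complex ^ 'd ^ 'd"
  have entry: "cmod (X $ i $ j) \<le> norm X" for i j
    using order_trans[OF Finite_Cartesian_Product.norm_nth_le Finite_Cartesian_Product.norm_nth_le] .
  have "cscale (X $ i $ j) (E i j) $ p $ q = (if j = q then if i = p then X $ i $ j else 0 else 0)"
    for i j p q
    by (simp add: cscale_def E_def axis_def)
  then have X: "X = (\<Sum>i\<in>UNIV. \<Sum>j\<in>UNIV. cscale (X $ i $ j) (E i j))"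
    by (simp add: vec_eq_iff)
  have "N X \<le> (\<Sum>i\<in>UNIV. N (\<Sum>j\<in>UNIV. cscale (X $ i $ j) (E i j)))"
    by (subst X) (rule sum_le[OF finite])
  also have "\<dots> \<le> (\<Sum>i\<in>UNIV. \<Sum>j\<in>UNIV. N (cscale (X $ i $ j) (E i j)))"
    by (intro sum_mono sum_le finite)
  also have "\<dots> \<le> (\<Sum>i\<in>UNIV. \<Sum>j\<in>UNIV. norm X * N (E i j))"
    unfolding scale by (intro sum_mono mult_right_mono entry nonneg)
  also have "\<dots> = ?C * norm X"
    by (simp add: sum_distrib_left mult.commute)
  also have "\<dots> \<le> (?C + 1) * norm X"
    by (simp add: distrib_right)
  finally show "N X \<le> (?C + 1) * norm X" .
qed

text \<open>Transfers Euclidean closeness to the distance in \<open>N\<close>. Convergence is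
  checked by order bounds, as the values are extended reals.\<close>

lemma set_dist_tendsto_0:
  assumes N: "is_norm N"
    and near: "\<And>e. e > 0 \<Longrightarrow> \<forall>\<^sub>F n in sequentially. \<exists>z\<in>S. dist (x n) z < e"
  shows "(\<lambda>n. set_dist N (x n) S) \<longlonglongrightarrow> 0"
proof (rule order_tendstoI)
  fix a :: ereal
  assume "a < 0"
  moreover have "0 \<le> set_dist N (x n) S" for n
    using N by (auto simp: set_dist_def is_norm_def intro!: INF_greatest)
  ultimately show "\<forall>\<^sub>F n in sequentially. a < set_dist N (x n) S"
    by (intro always_eventually allI) (rule less_le_trans)
next
  fix a :: ereal
  assume "0 < a"
  \<comment> \<open>The bound \<open>a\<close> may be infinite, so a real number strictly between 0
    and \<open>a\<close> takes its place.\<close>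
  then obtain e where e: "0 < e" "ereal e < a"
    using ereal_dense2 zero_ereal_def by (metis ereal_less(2))
  obtain C where C: "C > 0" "\<And>X. N X \<le> C * norm X"
    using is_norm_le_norm[OF N] by blast
  have "\<forall>\<^sub>F n in sequentially. \<exists>z\<in>S. dist (x n) z < e / C"
    using e C by (intro near) simp
  then show "\<forall>\<^sub>F n in sequentially. set_dist N (x n) S < a"
  proof eventually_elim
    case (elim n)
    then obtain z where z: "z \<in> S" "dist (x n) z < e / C" by blast
    have "set_dist N (x n) S \<le> N (x n - z)"
      unfolding set_dist_def using z(1) by (rule INF_lower)
    also have "N (x n - z) \<le> C * dist (x n) z"
      unfolding dist_norm by (rule C)
    then have "ereal (N (x n - z)) \<le> e"
      using z(2) C(1) by (simp add: field_simps)
    also note e(2)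
    finally show ?case .
  qed
qed

theorem theorem6p13:
  fixes H :: "nat \<Rightarrow> complex ^ 'd ^ 'd"
    and m :: nat
    and \<rho> :: "real \<Rightarrow> complex ^ 'd ^ 'd"
    and V :: "complex ^ 'd ^ 'd \<Rightarrow> real"
    and u :: "nat \<Rightarrow> real \<Rightarrow> real"
    and \<kappa> :: "nat \<Rightarrow> nat \<Rightarrow> real"
    and \<alpha> :: "nat \<Rightarrow> real"
    and t0 \<tau> Vmax :: real
    and N :: "complex ^ 'd ^ 'd \<Rightarrow> real"
  assumes tau_pos: "\<tau> > 0"
    and hermitian: "\<And>k. k \<in> {1..m} \<Longrightarrow> hermitian_matrix (H k)"
    and norm: "is_norm N"
    and V_cont: "continuous_on density_operators V"
    and V_nonneg: "\<And>\<sigma>. \<sigma> \<in> density_operators \<Longrightarrow> 0 \<le> V \<sigma>"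
    and state: "\<And>s. t0 \<le> s \<Longrightarrow> \<rho> s \<in> density_operators"
    and dynamics: "controlled_evolution m H u t0 \<tau> \<rho>"
    and bounded: "\<And>n. 0 \<le> V (\<rho> (sample_time t0 \<tau> n)) \<and> V (\<rho> (sample_time t0 \<tau> n)) \<le> Vmax"
    and controller: "adaptive_sign_controller m \<alpha> \<kappa> u t0 \<tau> (\<lambda>n. V (\<rho> (sample_time t0 \<tau> n)))"
    and descent: "\<And>\<sigma> n. \<lbrakk>\<sigma> \<in> density_operators; \<sigma> \<notin> zero_set V; \<rho> (sample_time t0 \<tau> n) = \<sigma>;
        \<not> constant_on_window (\<lambda>n. V (\<rho> (sample_time t0 \<tau> n))) n\<rbrakk>
        \<Longrightarrow> V (\<rho> (sample_time t0 \<tau> (Suc n))) - V (\<rho> (sample_time t0 \<tau> n)) < 0"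
    and target_invariant: "\<And>n. \<rho> (sample_time t0 \<tau> n) \<in> zero_set V
        \<Longrightarrow> \<rho> (sample_time t0 \<tau> (Suc n)) \<in> zero_set V"
    and no_stagnation: "\<And>L. L > 0 \<Longrightarrow> \<not> (\<lambda>n. V (\<rho> (sample_time t0 \<tau> n))) \<longlonglongrightarrow> L"
  shows "convergent (\<lambda>n. V (\<rho> (sample_time t0 \<tau> n)))
    \<and> lim (\<lambda>n. V (\<rho> (sample_time t0 \<tau> n))) = 0
    \<and> (\<lambda>n. set_dist N (\<rho> (sample_time t0 \<tau> n)) (zero_set V)) \<longlonglongrightarrow> 0
    \<and> ((\<forall>\<sigma>\<in>density_operators. V \<sigma> = 0 \<longleftrightarrow> \<sigma> \<in> zero_set V)
        \<longrightarrow> (\<lambda>n. set_dist N (\<rho> (sample_time t0 \<tau> n)) (zero_set V)) \<longlonglongrightarrow> 0)"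
proof -
  define x where "x n = \<rho> (sample_time t0 \<tau> n)" for n
  have x: "x n \<in> density_operators" for n
    unfolding x_def using tau_pos by (intro state) (simp add: sample_time_def)
  have "V (x (Suc n)) \<le> V (x n)" for n
  \<comment> \<open>The descent assumption speaks only about states off the zero set; on it,
    invariance keeps the next sample at 0.\<close>
  proof (cases "x n \<in> zero_set V")
    case True
    then show ?thesis
      using target_invariant[of n] by (simp add: x_def zero_set_def)
  next
    case False
    then show ?thesis
      using descent[OF x False, folded x_def, OF refl]
      \<comment> \<open>Equal samples are exactly a locally constant window; otherwise descent is
        strict.\<close>
      by (cases "V (x (Suc n)) = V (x n)") (auto simp: constant_on_window_def)
  qed
  then have "decseq (\<lambda>n. V (x n))"
    by (rule decseq_SucI)
  then obtain L where L: "(\<lambda>n. V (x n)) \<longlonglongrightarrow> L"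
    using decseq_convergent[of "\<lambda>n. V (x n)" 0] V_nonneg x by blast
  moreover have "0 \<le> L"
    using L by (rule LIMSEQ_le_const) (use V_nonneg x in blast)
  \<comment> \<open>The limit is nonnegative, and a positive one is excluded as stagnation.\<close>
  ultimately have lim: "(\<lambda>n. V (x n)) \<longlonglongrightarrow> 0"
    using no_stagnation[of L] unfolding x_def by (cases "L = 0") auto
  have "(\<lambda>n. set_dist N (x n) (zero_set V)) \<longlonglongrightarrow> 0"
    using norm
  proof (rule set_dist_tendsto_0)
    fix e :: real
    assume "e > 0"
    with compact_density_operators V_cont V_nonneg x lim
    show "\<forall>\<^sub>F n in sequentially. \<exists>z\<in>zero_set V. dist (x n) z < e"
      unfolding zero_set_def by (rule compact_minimizing_sequence)
  qed
  then show ?thesis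
    using lim convergentI[OF lim] limI[OF lim] unfolding x_def by blast
qed

end
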